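(* Let $G$ and $H$ be two connected graphs of orders $n_1\ge 2$ and $n_2\ge 2$ and maximum degrees $\Delta_1$ and $\Delta_2$, respectively. (i) If $\Delta_1\ne n_1-1$ or $\Delta_2\ne n_2-1$, then $\dim_s(G+H)=n_1+n_2-\varpi(G)-\varpi(H)\ge \dim_s(G)+\dim_s(H)$. (ii) If $G$ and $H$ both have diameter two and $\Delta_1\ne n_1-1$ or $\Delta_2\ne n_2-1$, then $\dim_s(G+H)=\dim_s(G)+\dim_s(H)$. (iii) If $\Delta_1=n_1-1$ and $\Delta_2=n_2-1$, then $\dim_s(G+H)=\dim_s(G)+\dim_s(H)+1$.
   Context: All graphs are finite and simple. For a connected graph $X$, $I_X[u,v]$ is the set of vertices on some shortest $u$–$v$ path; a vertex $w$ strongly resolves $u,v$ if $v\in I_X[u,w]$ or $u\in I_X[v,w]$; a strong resolving set is a vertex set $S$ such that every two distinct vertices are strongly resolved by some vertex of $S$; $\dim_s(X)$ is the minimum size of a strong resolving set. The join $G+H$ is obtained from disjoint copies of $G$ and $H$ by joining every vertex of $G$ to every vertex of $H$. True twins are distinct vertices with equal closed neighborhoods; a twin-free clique is a clique containing no two true twins; $\varpi(X)$ is the maximum size of a twin-free clique of $X$. *)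

theory Defs
  imports "Graph_Theory.Graph_Theory"
begin

text \<open>
  A finite simple graph is a \<^locale>\<open>pair_graph\<close>: a finite vertex set with a symmetric, loop-free
  arc relation, each edge being represented by its two opposite arcs.
\<close>

text \<open>In a symmetric loop-free arc relation, out-degree, in-degree and degree coincide.\<close>

definition max_degree :: "'a pair_pre_digraph \<Rightarrow> nat" where
  "max_degree G = Max (out_degree (with_proj G) ` pverts G)"

definition graph_dist :: "'a pair_pre_digraph \<Rightarrow> 'a \<Rightarrow> 'a \<Rightarrow> nat" where
  "graph_dist G u v = (LEAST k. \<exists>p. pre_digraph.apath (with_proj G) u p v \<and> length p = k)"

definition graph_diameter :: "'a pair_pre_digraph \<Rightarrow> nat" where
  "graph_diameter G = Max {graph_dist G u v | u v. u \<in> pverts G \<and> v \<in> pverts G}"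

text \<open>A path is the list of its arcs, so its length is its number of edges.\<close>

definition shortest_path ::
  "'a pair_pre_digraph \<Rightarrow> 'a \<Rightarrow> ('a \<times> 'a) awalk \<Rightarrow> 'a \<Rightarrow> bool" where
  "shortest_path G u p v \<longleftrightarrow>
     pre_digraph.apath (with_proj G) u p v \<and> length p = graph_dist G u v"

definition path_interval :: "'a pair_pre_digraph \<Rightarrow> 'a \<Rightarrow> 'a \<Rightarrow> 'a set" where
  "path_interval G u v = {w. \<exists>p. shortest_path G u p v \<and> w \<in> set (pawalk_verts u p)}"

definition strongly_resolves :: "'a pair_pre_digraph \<Rightarrow> 'a \<Rightarrow> 'a \<Rightarrow> 'a \<Rightarrow> bool" where
  "strongly_resolves G w u v \<longleftrightarrow> v \<in> path_interval G u w \<or> u \<in> path_interval G v w"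

definition strong_resolving_set :: "'a pair_pre_digraph \<Rightarrow> 'a set \<Rightarrow> bool" where
  "strong_resolving_set G S \<longleftrightarrow>
     S \<subseteq> pverts G \<and>
     (\<forall>u\<in>pverts G. \<forall>v\<in>pverts G. u \<noteq> v \<longrightarrow> (\<exists>w\<in>S. strongly_resolves G w u v))"

definition strong_metric_dim :: "'a pair_pre_digraph \<Rightarrow> nat" where
  "strong_metric_dim G = Min (card ` {S. strong_resolving_set G S})"

definition graph_join ::
  "'a pair_pre_digraph \<Rightarrow> 'b pair_pre_digraph \<Rightarrow> ('a + 'b) pair_pre_digraph" where
  "graph_join G H = \<lparr>
     pverts = pverts G <+> pverts H,
     parcs = {(Inl u, Inl v) | u v. (u, v) \<in> parcs G}
           \<union> {(Inr u, Inr v) | u v. (u, v) \<in> parcs H}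
           \<union> {(Inl u, Inr v) | u v. u \<in> pverts G \<and> v \<in> pverts H}
           \<union> {(Inr v, Inl u) | u v. u \<in> pverts G \<and> v \<in> pverts H} \<rparr>"

definition closed_nbhd :: "'a pair_pre_digraph \<Rightarrow> 'a \<Rightarrow> 'a set" where
  "closed_nbhd G v = insert v {w. (v, w) \<in> parcs G}"

definition true_twins :: "'a pair_pre_digraph \<Rightarrow> 'a \<Rightarrow> 'a \<Rightarrow> bool" where
  "true_twins G u v \<longleftrightarrow> u \<noteq> v \<and> closed_nbhd G u = closed_nbhd G v"

definition is_clique :: "'a pair_pre_digraph \<Rightarrow> 'a set \<Rightarrow> bool" where
  "is_clique G S \<longleftrightarrow>
     S \<subseteq> pverts G \<and> (\<forall>u\<in>S. \<forall>v\<in>S. u \<noteq> v \<longrightarrow> (u, v) \<in> parcs G)"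

text \<open>Twins are taken with respect to neighborhoods in the whole graph, not within the clique.\<close>

definition twin_free_clique :: "'a pair_pre_digraph \<Rightarrow> 'a set \<Rightarrow> bool" where
  "twin_free_clique G S \<longleftrightarrow> is_clique G S \<and> (\<forall>u\<in>S. \<forall>v\<in>S. \<not> true_twins G u v)"

definition twin_free_clique_number :: "'a pair_pre_digraph \<Rightarrow> nat" where
  "twin_free_clique_number G = Max (card ` {S. twin_free_clique G S})"

lemma pair_graph_graph_join:
  assumes "pair_graph G" "pair_graph H"
  shows "pair_graph (graph_join G H)"
proof -
  interpret G: pair_graph G by fact
  interpret H: pair_graph H by fact
  let ?J = "graph_join G H"
  have sub: "parcs ?J \<subseteq> pverts ?J \<times> pverts ?J"
    by (auto simp: graph_join_def dest: G.wellformed' H.wellformed')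
  have fin: "finite (pverts ?J)"
    by (simp add: graph_join_def)
  show ?thesis
  proof
    show "finite (parcs ?J)"
      using sub fin by (meson finite_SigmaI finite_subset)
    show "symmetric (with_proj ?J)"
      unfolding symmetric_def sym_def
      by (auto simp: graph_join_def intro: G.arcs_symmetric H.arcs_symmetric)
    show "fst e \<noteq> snd e" if "e \<in> parcs ?J" for e
      using that by (auto simp: graph_join_def dest: G.no_loops' H.no_loops')
  qed (use sub fin in auto)
qed

end

theory Submission
  imports Defs
begin

text \<open>
  Two adjacent vertices that are not true twins are strongly resolved by any vertex adjacent to
  exactly one of them, and this vertex lies outside every clique containing both. So the
  complement of a twin-free clique is a strong resolving set. If any two nonadjacent vertices have
  a common neighbor, the converse holds: when \<open>w\<close> strongly resolves \<open>u\<close> and \<open>v\<close> and differs from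
  both, one of \<open>u\<close>, \<open>v\<close> is the midpoint of a path of length two from \<open>w\<close> to the other, so \<open>u\<close> and
  \<open>v\<close> are adjacent and not twins. Hence the strong metric dimension of such a graph is its order
  minus its twin-free clique number.

  The join is such a graph. Its cliques are unions of a clique of each factor, and the only true
  twins across the factors are pairs of universal vertices. If one factor has no universal vertex,
  the twin-free clique numbers add up; otherwise every maximum twin-free clique of each factor
  contains exactly one universal vertex, and one of these two vertices has to be dropped.
\<close>

text \<open>An arc-level form of diameter at most two, which also covers complete and empty graphs.
  The join satisfies it, as do diameter-two factors and factors with a universal vertex.\<close>

definition common_nbrs :: "'a pair_pre_digraph \<Rightarrow> bool" where
  "common_nbrs G \<longleftrightarrow>
     (\<forall>u\<in>pverts G. \<forall>v\<in>pverts G. u \<noteq> v \<longrightarrow> (u, v) \<notin> parcs G \<longrightarrow>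
        (\<exists>w. (u, w) \<in> parcs G \<and> (w, v) \<in> parcs G))"

definition universal_verts :: "'a pair_pre_digraph \<Rightarrow> 'a set" where
  "universal_verts G = {v \<in> pverts G. \<forall>w\<in>pverts G. w \<noteq> v \<longrightarrow> (v, w) \<in> parcs G}"

lemma length_le_two_cases:
  assumes "length p \<le> 2"
  obtains "p = []" | e where "p = [e]" | e f where "p = [e, f]"
  using assms by (auto simp: le_Suc_eq length_Suc_conv numeral_2_eq_2)

lemma pcas_last_in_verts: "pcas u p v \<Longrightarrow> v \<in> set (pawalk_verts u p)"
  by (induction p arbitrary: u) auto

section \<open>Shortest paths\<close>

context pair_graph
begin

lemma graph_dist_le: "apath u p v \<Longrightarrow> graph_dist G u v \<le> length p"
  unfolding graph_dist_def by (rule Least_le) auto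

lemma shortest_path_exists:
  assumes "apath u p v"
  shows "\<exists>q. shortest_path G u q v"
  unfolding shortest_path_def graph_dist_def
  using LeastI[of "\<lambda>k. \<exists>p. apath u p v \<and> length p = k" "length p"] assms by auto

lemma apath_arc: "(u, v) \<in> parcs G \<Longrightarrow> apath u [(u, v)] v"
  using wellformed' no_loops' by (auto simp: apath_simps)

lemma apath_two_arcs:
  assumes "(u, w) \<in> parcs G" "(w, v) \<in> parcs G" "u \<noteq> v"
  shows "apath u [(u, w), (w, v)] v"
  using assms wellformed' no_loops' by (auto simp: apath_simps)

text \<open>An inner vertex forces a shortest path of length at most two to consist of exactly two
  arcs, and a direct arc from \<open>u\<close> to \<open>v\<close> would be shorter.\<close>

lemma path_intervalD:
  assumes "w \<in> path_interval G u v" "w \<noteq> u" "w \<noteq> v" "graph_dist G u v \<le> 2"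
  shows "(u, w) \<in> parcs G" "(w, v) \<in> parcs G" "(u, v) \<notin> parcs G" "u \<noteq> v"
proof -
  obtain p where p: "apath u p v" "length p = graph_dist G u v" "w \<in> set (pawalk_verts u p)"
    using assms(1) by (auto simp: path_interval_def shortest_path_def)
  from p(2) assms(4) have "length p \<le> 2" by simp
  then have two: "p = [(u, w), (w, v)]"
  proof (cases rule: length_le_two_cases)
    case (3 e f)
    with p assms show ?thesis
      by (cases e; cases f) (auto simp: apath_simps)
  qed (use p assms in \<open>auto simp: apath_simps\<close>)
  with p show "(u, w) \<in> parcs G" "(w, v) \<in> parcs G" "u \<noteq> v"
    by (auto simp: apath_simps)
  show "(u, v) \<notin> parcs G"
    using graph_dist_le[OF apath_arc, of u v] p(2) two by auto
qed

lemma path_interval_midpoint: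
  assumes "(u, w) \<in> parcs G" "(w, v) \<in> parcs G" "u \<noteq> v" "(u, v) \<notin> parcs G"
  shows "w \<in> path_interval G u v"
proof -
  have p: "apath u [(u, w), (w, v)] v"
    using assms apath_two_arcs by blast
  obtain q where q: "apath u q v" "length q = graph_dist G u v"
    using shortest_path_exists[OF p] by (auto simp: shortest_path_def)
  have "length q \<noteq> 0" using q(1) assms(3) by (auto simp: apath_simps)
  moreover have "length q \<noteq> Suc 0"
    using q(1) assms(4) by (auto simp: apath_simps length_Suc_conv)
  ultimately have "graph_dist G u v = 2"
    using graph_dist_le[OF p] q(2) by simp
  with p show ?thesis
    unfolding path_interval_def shortest_path_def
    by (auto intro!: exI[of _ "[(u, w), (w, v)]"])
qed

lemma path_interval_end:
  assumes "apath u p v"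
  shows "v \<in> path_interval G u v"
proof -
  obtain q where q: "shortest_path G u q v" using shortest_path_exists[OF assms] by blast
  then have "apath u q v" by (simp add: shortest_path_def)
  then have "v \<in> set (pawalk_verts u q)"
    by (auto simp: apath_def awalk_def intro: pcas_last_in_verts)
  with q show ?thesis by (auto simp: path_interval_def)
qed

section \<open>Distances in graphs with common neighbors\<close>

lemma common_nbrs_dist_le_two:
  assumes "common_nbrs G" "u \<in> pverts G" "v \<in> pverts G"
  shows "\<exists>p. apath u p v \<and> length p \<le> 2"
proof (cases "u = v")
  case True
  with assms show ?thesis by (intro exI[of _ "[]"]) (auto simp: apath_simps)
next
  case neq: False
  show ?thesis
  proof (cases "(u, v) \<in> parcs G")
    case True
    then show ?thesis using apath_arc by (intro exI[of _ "[(u, v)]"]) auto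
  next
    case False
    with neq assms obtain w where "(u, w) \<in> parcs G" "(w, v) \<in> parcs G"
      by (auto simp: common_nbrs_def)
    with neq show ?thesis
      using apath_two_arcs by (intro exI[of _ "[(u, w), (w, v)]"]) auto
  qed
qed

lemma common_nbrs_strongly_connected:
  assumes "common_nbrs G" "pverts G \<noteq> {}"
  shows "strongly_connected G"
proof (rule strongly_connectedI)
  fix u v assume "u \<in> verts G" "v \<in> verts G"
  with assms(1) show "u \<rightarrow>\<^sup>*\<^bsub>G\<^esub> v"
    using common_nbrs_dist_le_two[of u v] by (auto simp: reachable_apath)
qed (use assms(2) in simp)

lemma diameter_two_common_nbrs:
  assumes "strongly_connected G" "graph_diameter G = 2"
  shows "common_nbrs G"
  unfolding common_nbrs_def
proof (intro ballI impI)
  fix u v assume uv: "u \<in> pverts G" "v \<in> pverts G" "u \<noteq> v" "(u, v) \<notin> parcs G"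
  let ?D = "{graph_dist G u v | u v. u \<in> pverts G \<and> v \<in> pverts G}"
  \<comment> \<open>As an image of a finite product the set of distances is finite, so
    \<open>Max\<close> bounds each of them.\<close>
  have "?D = (\<lambda>(u, v). graph_dist G u v) ` (pverts G \<times> pverts G)" by auto
  then have "finite ?D" using pair_finite_verts by simp
  moreover have "graph_dist G u v \<in> ?D" using uv by auto
  ultimately have le: "graph_dist G u v \<le> 2"
    unfolding assms(2)[symmetric] graph_diameter_def by (rule Max_ge)
  \<comment> \<open>Some path must exist for the \<open>LEAST\<close> in \<open>graph_dist\<close>
    to be attained. Its length is then neither zero nor one, and the middle vertex is the common
    neighbor.\<close>
  obtain p where "apath u p v"
    using assms(1) uv by (auto simp: strongly_connected_def reachable_apath)
  then obtain q where q: "apath u q v" "length q \<le> 2"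
    using shortest_path_exists le by (fastforce simp: shortest_path_def)
  from q(2) show "\<exists>w. (u, w) \<in> parcs G \<and> (w, v) \<in> parcs G"
    using q(1) uv by (cases rule: length_le_two_cases) (auto simp: apath_simps)
qed

section \<open>Strong resolving sets and twin-free cliques\<close>

text \<open>Leaves only the pairs with both members outside a candidate resolving set to be
  examined.\<close>

lemma resolves_self:
  assumes "strongly_connected G" "u \<in> pverts G" "v \<in> pverts G"
  shows "strongly_resolves G u u v" "strongly_resolves G v u v"
proof -
  have "u \<in> path_interval G v u" "v \<in> path_interval G u v"
    using assms path_interval_end by (fastforce simp: strongly_connected_def reachable_apath)+
  then show "strongly_resolves G u u v" "strongly_resolves G v u v"
    by (simp_all add: strongly_resolves_def)
qed

lemma strong_resolving_set_Diff_clique: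
  assumes conn: "strongly_connected G" and C: "twin_free_clique G C"
  shows "strong_resolving_set G (pverts G - C)"
  unfolding strong_resolving_set_def
proof (intro conjI ballI impI)
  \<comment> \<open>Stated for \<open>z\<close> in the neighborhood of \<open>x\<close> only, so
    that it can be applied to a pair in either order.\<close>
  have resolved: "\<exists>w\<in>pverts G - C. strongly_resolves G w x y"
    if "x \<in> C" "y \<in> C" "x \<noteq> y" "z \<in> closed_nbhd G x" "z \<notin> closed_nbhd G y" for x y z
  proof -
    have cl: "\<And>a b. a \<in> C \<Longrightarrow> b \<in> C \<Longrightarrow> a \<noteq> b \<Longrightarrow> (a, b) \<in> parcs G"
      using C by (auto simp: twin_free_clique_def is_clique_def)
    have z: "(x, z) \<in> parcs G" "z \<noteq> y" "(y, z) \<notin> parcs G"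
      using that cl[of y x] by (auto simp: closed_nbhd_def)
    then have "x \<in> path_interval G y z"
      using cl[of y x] that by (intro path_interval_midpoint) auto
    \<comment> \<open>The clique contains \<open>y\<close>, and \<open>z\<close> is neither equal
      nor adjacent to \<open>y\<close>.\<close>
    moreover have "z \<in> pverts G - C" using z cl[of y z] that wellformed' by auto
    ultimately show ?thesis by (auto simp: strongly_resolves_def)
  qed
  fix u v assume uv: "u \<in> pverts G" "v \<in> pverts G" "u \<noteq> v"
  show "\<exists>w\<in>pverts G - C. strongly_resolves G w u v"
  proof (cases "u \<in> C \<and> v \<in> C")
    case True
    with C uv have "closed_nbhd G u \<noteq> closed_nbhd G v"
      by (auto simp: twin_free_clique_def true_twins_def)
    then consider z where "z \<in> closed_nbhd G u" "z \<notin> closed_nbhd G v"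
      | z where "z \<in> closed_nbhd G v" "z \<notin> closed_nbhd G u" by blast
    then show ?thesis
    proof cases
      case 1
      with resolved[of u v] True uv show ?thesis by blast
    next
      case 2
      with resolved[of v u] True uv show ?thesis by (auto simp: strongly_resolves_def)
    qed
  next
    case False
    with uv resolves_self[OF conn] show ?thesis by blast
  qed
qed blast

lemma twin_free_clique_Diff_resolving:
  assumes nbrs: "common_nbrs G" and S: "strong_resolving_set G S"
  shows "twin_free_clique G (pverts G - S)"
proof -
  \<comment> \<open>One of the two alternatives in \<open>strongly_resolves\<close>; the other
    follows by exchanging \<open>u\<close> and \<open>v\<close>. Since the distance from
    \<open>u\<close> to \<open>w\<close> is at most two, \<open>v\<close> is a midpoint, and
    \<open>w\<close> separates the two closed neighborhoods.\<close>
  have *: "(u, v) \<in> parcs G \<and> \<not> true_twins G u v"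
    if uv: "u \<in> pverts G - S" "v \<in> pverts G - S" "w \<in> S" "u \<noteq> v" "v \<in> path_interval G u w"
    for u v w
  proof -
    have w: "w \<in> pverts G" "w \<noteq> v" "w \<noteq> u"
      using uv S by (auto simp: strong_resolving_set_def)
    obtain p where "apath u p w" "length p \<le> 2"
      using common_nbrs_dist_le_two[OF nbrs, of u w] uv(1) w(1) by blast
    then have "graph_dist G u w \<le> 2" using graph_dist_le le_trans by blast
    from path_intervalD[OF uv(5) _ _ this] uv w
    have "(u, v) \<in> parcs G" "(v, w) \<in> parcs G" "(u, w) \<notin> parcs G" by auto
    moreover from this w have "w \<in> closed_nbhd G v" "w \<notin> closed_nbhd G u"
      by (auto simp: closed_nbhd_def)
    ultimately show ?thesis by (auto simp: true_twins_def)
  qed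
  have "(u, v) \<in> parcs G \<and> \<not> true_twins G u v"
    if uv: "u \<in> pverts G - S" "v \<in> pverts G - S" "u \<noteq> v" for u v
  proof -
    obtain w where "w \<in> S" "strongly_resolves G w u v"
      using S uv unfolding strong_resolving_set_def by blast
    then show ?thesis
      using *[of u v w] *[of v u w] uv arcs_symmetric
      by (auto simp: strongly_resolves_def true_twins_def)
  qed
  moreover have "\<not> true_twins G u u" for u by (simp add: true_twins_def)
  ultimately show ?thesis by (fastforce simp: twin_free_clique_def is_clique_def)
qed

section \<open>Extremal values and their attainment\<close>

lemma twin_free_clique_subset: "twin_free_clique G C \<Longrightarrow> C \<subseteq> pverts G"
  by (simp add: twin_free_clique_def is_clique_def)

lemma finite_twin_free_clique: "twin_free_clique G C \<Longrightarrow> finite C"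
  using twin_free_clique_subset pair_finite_verts finite_subset by blast

lemma finite_twin_free_cliques: "finite {C. twin_free_clique G C}"
  by (rule finite_subset[of _ "Pow (pverts G)"])
    (use twin_free_clique_subset pair_finite_verts in auto)

lemma card_le_twin_free_clique_number:
  "twin_free_clique G C \<Longrightarrow> card C \<le> twin_free_clique_number G"
  unfolding twin_free_clique_number_def using finite_twin_free_cliques by (intro Max_ge) auto

lemma twin_free_clique_number_attained:
  "\<exists>C. twin_free_clique G C \<and> card C = twin_free_clique_number G"
proof -
  \<comment> \<open>Ensures that the maximum is taken over a nonempty set.\<close>
  have "twin_free_clique G {}" by (simp add: twin_free_clique_def is_clique_def)
  then have "twin_free_clique_number G \<in> card ` {C. twin_free_clique G C}"
    unfolding twin_free_clique_number_def using finite_twin_free_cliques by (intro Max_in) auto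
  then show ?thesis by auto
qed

lemma finite_strong_resolving_sets: "finite {S. strong_resolving_set G S}"
  by (rule finite_subset[of _ "Pow (pverts G)"])
    (use pair_finite_verts in \<open>auto simp: strong_resolving_set_def\<close>)

lemma strong_metric_dim_le:
  "strong_resolving_set G S \<Longrightarrow> strong_metric_dim G \<le> card S"
  unfolding strong_metric_dim_def using finite_strong_resolving_sets by (intro Min_le) auto

lemma strong_metric_dim_attained:
  assumes "strong_resolving_set G S"
  shows "\<exists>S. strong_resolving_set G S \<and> card S = strong_metric_dim G"
proof -
  have "strong_metric_dim G \<in> card ` {S. strong_resolving_set G S}"
    unfolding strong_metric_dim_def
    using finite_strong_resolving_sets assms by (intro Min_in) auto
  then show ?thesis by auto
qed

text \<open>The complement of a maximum twin-free clique is a strong resolving set. The additive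
  form avoids truncated subtraction.\<close>

lemma strong_metric_dim_add_le:
  assumes "strongly_connected G"
  shows "strong_metric_dim G + twin_free_clique_number G \<le> card (pverts G)"
proof -
  obtain C where C: "twin_free_clique G C" "card C = twin_free_clique_number G"
    using twin_free_clique_number_attained by blast
  have "strong_metric_dim G \<le> card (pverts G - C)"
    using strong_metric_dim_le[OF strong_resolving_set_Diff_clique[OF assms C(1)]] .
  moreover have "card (pverts G - C) = card (pverts G) - card C"
    using finite_twin_free_clique[OF C(1)] twin_free_clique_subset[OF C(1)]
    by (rule card_Diff_subset)
  moreover have "card C \<le> card (pverts G)"
    using twin_free_clique_subset[OF C(1)] pair_finite_verts by (rule card_mono[rotated])
  ultimately show ?thesis using C(2) by simp
qed

lemma strong_metric_dim_add_eq:
  assumes "common_nbrs G" "pverts G \<noteq> {}"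
  shows "strong_metric_dim G + twin_free_clique_number G = card (pverts G)"
proof (rule antisym)
  have conn: "strongly_connected G" using common_nbrs_strongly_connected assms by blast
  then show "strong_metric_dim G + twin_free_clique_number G \<le> card (pverts G)"
    by (rule strong_metric_dim_add_le)
  obtain S where S: "strong_resolving_set G S" "card S = strong_metric_dim G"
    using strong_metric_dim_attained strong_resolving_set_Diff_clique[OF conn]
      twin_free_clique_number_attained by blast
  have "S \<subseteq> pverts G" using S(1) by (simp add: strong_resolving_set_def)
  then have "card (pverts G) = card S + card (pverts G - S)"
    using pair_finite_verts by (metis card_Diff_subset card_mono finite_subset le_add_diff_inverse)
  \<comment> \<open>This is the direction that relies on common neighbors: the complement of a
    minimum strong resolving set is a twin-free clique.\<close>
  also have "card (pverts G - S) \<le> twin_free_clique_number G"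
    using card_le_twin_free_clique_number twin_free_clique_Diff_resolving assms S by blast
  finally show "card (pverts G) \<le> strong_metric_dim G + twin_free_clique_number G"
    using S(2) by simp
qed

section \<open>Universal vertices\<close>

lemma closed_nbhd_subset: "v \<in> pverts G \<Longrightarrow> closed_nbhd G v \<subseteq> pverts G"
  using wellformed' by (auto simp: closed_nbhd_def)

lemma universal_iff_closed_nbhd:
  "v \<in> pverts G \<Longrightarrow> v \<in> universal_verts G \<longleftrightarrow> closed_nbhd G v = pverts G"
  using wellformed' by (auto simp: universal_verts_def closed_nbhd_def)

text \<open>Out-arcs at \<open>v\<close> correspond to its neighbors; the closed neighborhood has
  one more element, \<open>v\<close> itself, since there are no loops.\<close>

lemma out_degree_eq: "v \<in> pverts G \<Longrightarrow> out_degree G v = card (closed_nbhd G v) - 1"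
proof -
  assume v: "v \<in> pverts G"
  have "out_arcs G v = Pair v ` {w. (v, w) \<in> parcs G}" by (auto simp: out_arcs_def)
  then have "out_degree G v = card {w. (v, w) \<in> parcs G}"
    by (simp add: out_degree_def card_image inj_on_def)
  moreover have "finite {w. (v, w) \<in> parcs G}"
    using wellformed' pair_finite_verts by (auto intro: finite_subset[of _ "pverts G"])
  moreover have "v \<notin> {w. (v, w) \<in> parcs G}" using no_loops' by auto
  ultimately show ?thesis by (simp add: closed_nbhd_def)
qed

lemma max_degree_eq_iff:
  assumes "pverts G \<noteq> {}"
  shows "max_degree G = card (pverts G) - 1 \<longleftrightarrow> universal_verts G \<noteq> {}"
proof -
  have deg: "out_degree G v = card (pverts G) - 1 \<longleftrightarrow> v \<in> universal_verts G"
    if v: "v \<in> pverts G" for v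
  proof -
    have fin: "finite (closed_nbhd G v)"
      using closed_nbhd_subset[OF v] pair_finite_verts finite_subset by blast
    \<comment> \<open>Positivity allows the truncated subtraction of one to be cancelled on both
      sides.\<close>
    have "card (closed_nbhd G v) > 0" "card (pverts G) > 0"
      using fin pair_finite_verts v by (auto simp: card_gt_0_iff closed_nbhd_def)
    then have "out_degree G v = card (pverts G) - 1
        \<longleftrightarrow> card (closed_nbhd G v) = card (pverts G)"
      using out_degree_eq[OF v] by auto
    also have "\<dots> \<longleftrightarrow> closed_nbhd G v = pverts G"
      using card_subset_eq[OF pair_finite_verts closed_nbhd_subset[OF v]] by auto
    finally show ?thesis using universal_iff_closed_nbhd[OF v] by simp
  qed
  have le: "out_degree G v \<le> card (pverts G) - 1" if v: "v \<in> pverts G" for v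
    using out_degree_eq[OF v] card_mono[OF pair_finite_verts closed_nbhd_subset[OF v]] by simp
  have "max_degree G = card (pverts G) - 1
      \<longleftrightarrow> (\<exists>v\<in>pverts G. out_degree G v = card (pverts G) - 1)"
  proof -
    have "finite (out_degree G ` pverts G)" "out_degree G ` pverts G \<noteq> {}"
      using assms pair_finite_verts by simp_all
    then show ?thesis
      unfolding max_degree_def using le by (simp add: Max_eq_iff image_iff) metis
  qed
  also have "\<dots> \<longleftrightarrow> universal_verts G \<noteq> {}"
    using deg by (auto simp: universal_verts_def)
  finally show ?thesis .
qed

text \<open>A universal vertex cannot belong to a nonadjacent pair, so it is a common neighbor of
  every such pair.\<close>

lemma universal_common_nbrs:
  assumes "universal_verts G \<noteq> {}"
  shows "common_nbrs G"
  unfolding common_nbrs_def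
proof (intro ballI impI)
  fix u v assume uv: "u \<in> pverts G" "v \<in> pverts G" "u \<noteq> v" "(u, v) \<notin> parcs G"
  obtain x where x: "x \<in> pverts G" "\<And>w. w \<in> pverts G \<Longrightarrow> w \<noteq> x \<Longrightarrow> (x, w) \<in> parcs G"
    using assms by (auto simp: universal_verts_def)
  with uv arcs_symmetric[of v u] have "x \<noteq> u" "x \<noteq> v" by auto
  with x uv arcs_symmetric show "\<exists>w. (u, w) \<in> parcs G \<and> (w, v) \<in> parcs G" by metis
qed

lemma twin_free_clique_insert_universal:
  assumes C: "twin_free_clique G C" and x: "x \<in> universal_verts G"
    and disj: "C \<inter> universal_verts G = {}"
  shows "twin_free_clique G (insert x C)"
proof -
  have xV: "x \<in> pverts G" using x by (simp add: universal_verts_def)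
  have "closed_nbhd G x \<noteq> closed_nbhd G y" if "y \<in> C" for y
  proof -
    have "y \<in> pverts G" "y \<notin> universal_verts G"
      using that disj twin_free_clique_subset[OF C] by auto
    then show ?thesis using x xV by (metis universal_iff_closed_nbhd)
  qed
  then have "\<not> true_twins G x y" "\<not> true_twins G y x" if "y \<in> C" for y
    using that unfolding true_twins_def by metis+
  moreover have "(x, y) \<in> parcs G" "(y, x) \<in> parcs G" if "y \<in> C" "y \<noteq> x" for y
    using that x twin_free_clique_subset[OF C] arcs_symmetric by (auto simp: universal_verts_def)
  moreover have "\<not> true_twins G x x" by (simp add: true_twins_def)
  ultimately show ?thesis
    using C xV by (auto simp: twin_free_clique_def is_clique_def)
qed

text \<open>Such a clique can be enlarged by a universal vertex. The strictness yields the offset of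
  one in the join of two graphs with universal vertices.\<close>

lemma card_less_twin_free_clique_number:
  assumes "twin_free_clique G C" "universal_verts G \<noteq> {}" "C \<inter> universal_verts G = {}"
  shows "card C < twin_free_clique_number G"
proof -
  obtain x where x: "x \<in> universal_verts G" using assms by auto
  then have "x \<notin> C" using assms by auto
  with card_le_twin_free_clique_number[OF twin_free_clique_insert_universal[OF assms(1) x assms(3)]]
  show ?thesis using finite_twin_free_clique[OF assms(1)] by simp
qed

text \<open>Any two distinct universal vertices are true twins, both having the whole vertex set as
  closed neighborhood.\<close>

lemma card_clique_Int_universal:
  assumes "twin_free_clique G C"
  shows "card (C \<inter> universal_verts G) \<le> 1"
proof -
  have "u = v" if "u \<in> C \<inter> universal_verts G" "v \<in> C \<inter> universal_verts G" for u v
  proof -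
    have "closed_nbhd G u = closed_nbhd G v"
      using that universal_iff_closed_nbhd[of u] universal_iff_closed_nbhd[of v]
      by (auto simp: universal_verts_def)
    then show ?thesis using that assms by (auto simp: twin_free_clique_def true_twins_def)
  qed
  then show ?thesis
    using finite_twin_free_clique[OF assms] by (simp add: card_le_Suc0_iff_eq)
qed

lemma twin_free_clique_mono: "twin_free_clique G C \<Longrightarrow> D \<subseteq> C \<Longrightarrow> twin_free_clique G D"
  unfolding twin_free_clique_def is_clique_def by blast

end

section \<open>The join\<close>

lemma Plus_eq_iff: "A <+> B = C <+> D \<longleftrightarrow> A = C \<and> B = D"
proof -
  have "A = {a. Inl a \<in> A <+> B}" "B = {b. Inr b \<in> A <+> B}" for A :: "'c set" and B :: "'d set"
    by auto
  then show ?thesis by metis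
qed

lemma ball_Plus:
  "(\<forall>u\<in>A <+> B. P u) \<longleftrightarrow> (\<forall>a\<in>A. P (Inl a)) \<and> (\<forall>b\<in>B. P (Inr b))"
  by auto

lemma graph_join_simps [simp]:
  "pverts (graph_join G H) = pverts G <+> pverts H"
  "(Inl a, Inl b) \<in> parcs (graph_join G H) \<longleftrightarrow> (a, b) \<in> parcs G"
  "(Inr c, Inr d) \<in> parcs (graph_join G H) \<longleftrightarrow> (c, d) \<in> parcs H"
  "(Inl a, Inr c) \<in> parcs (graph_join G H) \<longleftrightarrow> a \<in> pverts G \<and> c \<in> pverts H"
  "(Inr c, Inl a) \<in> parcs (graph_join G H) \<longleftrightarrow> a \<in> pverts G \<and> c \<in> pverts H"
  by (auto simp: graph_join_def)

text \<open>Distinct nonadjacent vertices lie in the same factor, and any vertex of the other factor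
  is adjacent to both.\<close>

lemma common_nbrs_graph_join:
  assumes "pverts G \<noteq> {}" "pverts H \<noteq> {}"
  shows "common_nbrs (graph_join G H)"
proof -
  obtain a b where ab: "a \<in> pverts G" "b \<in> pverts H" using assms by auto
  then show ?thesis
    unfolding common_nbrs_def
    by (auto intro: exI[of _ "Inl a"] exI[of _ "Inr b"])
qed

locale two_graphs = G: pair_graph G + H: pair_graph H
  for G :: "'a pair_pre_digraph" and H :: "'b pair_pre_digraph"
begin

sublocale J: pair_graph "graph_join G H"
  by (rule pair_graph_graph_join) unfold_locales

section \<open>Twins and twin-free cliques in the join\<close>

lemma closed_nbhd_join:
  "a \<in> pverts G \<Longrightarrow> closed_nbhd (graph_join G H) (Inl a) = closed_nbhd G a <+> pverts H"
  "b \<in> pverts H \<Longrightarrow> closed_nbhd (graph_join G H) (Inr b) = pverts G <+> closed_nbhd H b"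
  by (auto simp: closed_nbhd_def graph_join_def)

text \<open>Closed neighborhoods are compared componentwise. Within a factor the other component is
  constant; across factors, equality forces both components to be full vertex sets.\<close>

lemma true_twins_join:
  "a \<in> pverts G \<Longrightarrow> a' \<in> pverts G \<Longrightarrow>
     true_twins (graph_join G H) (Inl a) (Inl a') \<longleftrightarrow> true_twins G a a'"
  "b \<in> pverts H \<Longrightarrow> b' \<in> pverts H \<Longrightarrow>
     true_twins (graph_join G H) (Inr b) (Inr b') \<longleftrightarrow> true_twins H b b'"
  "a \<in> pverts G \<Longrightarrow> b \<in> pverts H \<Longrightarrow>
     true_twins (graph_join G H) (Inl a) (Inr b)
       \<longleftrightarrow> a \<in> universal_verts G \<and> b \<in> universal_verts H"
  "a \<in> pverts G \<Longrightarrow> b \<in> pverts H \<Longrightarrow>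
     true_twins (graph_join G H) (Inr b) (Inl a)
       \<longleftrightarrow> a \<in> universal_verts G \<and> b \<in> universal_verts H"
  by (auto simp only: true_twins_def closed_nbhd_join Plus_eq_iff G.universal_iff_closed_nbhd
      H.universal_iff_closed_nbhd sum.inject sum.distinct)

lemma twin_free_clique_join_iff:
  "twin_free_clique (graph_join G H) (A <+> B) \<longleftrightarrow>
     twin_free_clique G A \<and> twin_free_clique H B \<and>
     (A \<inter> universal_verts G = {} \<or> B \<inter> universal_verts H = {})"
proof (cases "A \<subseteq> pverts G \<and> B \<subseteq> pverts H")
  case True
  then have V: "\<And>a. a \<in> A \<Longrightarrow> a \<in> pverts G" "\<And>b. b \<in> B \<Longrightarrow> b \<in> pverts H" by auto
  have "is_clique (graph_join G H) (A <+> B) \<longleftrightarrow> is_clique G A \<and> is_clique H B"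
  proof -
    have "A <+> B \<subseteq> pverts G <+> pverts H" using True by auto
    then show ?thesis
      using True V by (simp add: is_clique_def ball_Plus)
  qed
  moreover have "(\<forall>u\<in>A <+> B. \<forall>v\<in>A <+> B. \<not> true_twins (graph_join G H) u v) \<longleftrightarrow>
      (\<forall>u\<in>A. \<forall>v\<in>A. \<not> true_twins G u v) \<and> (\<forall>u\<in>B. \<forall>v\<in>B. \<not> true_twins H u v) \<and>
      (A \<inter> universal_verts G = {} \<or> B \<inter> universal_verts H = {})"
    using V by (simp add: ball_Plus true_twins_join) blast
  ultimately show ?thesis unfolding twin_free_clique_def by blast
next
  case False
  then show ?thesis
    by (auto simp: twin_free_clique_def is_clique_def)
qed

lemma twin_free_clique_join_cases:
  assumes "twin_free_clique (graph_join G H) C"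
  obtains A B where "C = A <+> B" "twin_free_clique G A" "twin_free_clique H B"
    "A \<inter> universal_verts G = {} \<or> B \<inter> universal_verts H = {}"
    "card C = card A + card B"
proof -
  \<comment> \<open>Every set in a sum type is the sum of its preimages under the two
    injections.\<close>
  have "C = (Inl -` C) <+> (Inr -` C)"
    by (metis Plus_def image_vimage_eq Int_Un_distrib UNIV_sum Int_UNIV_right)
  then obtain A B where C: "C = A <+> B" by blast
  with assms twin_free_clique_join_iff that show thesis
    by (metis card_Plus G.finite_twin_free_clique H.finite_twin_free_clique)
qed

lemma card_Plus_le_join:
  assumes "twin_free_clique G A" "twin_free_clique H B"
    "A \<inter> universal_verts G = {} \<or> B \<inter> universal_verts H = {}"
  shows "card A + card B \<le> twin_free_clique_number (graph_join G H)"
  using J.card_le_twin_free_clique_number[of "A <+> B"] assms twin_free_clique_join_iff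
    G.finite_twin_free_clique H.finite_twin_free_clique by (simp add: card_Plus)

lemma twin_free_clique_number_join:
  assumes "universal_verts G = {} \<or> universal_verts H = {}"
  shows "twin_free_clique_number (graph_join G H)
    = twin_free_clique_number G + twin_free_clique_number H"
proof (rule antisym)
  obtain C where C: "twin_free_clique (graph_join G H) C"
      "card C = twin_free_clique_number (graph_join G H)"
    using J.twin_free_clique_number_attained by blast
  show "twin_free_clique_number (graph_join G H)
      \<le> twin_free_clique_number G + twin_free_clique_number H"
    using C(1)
  proof (rule twin_free_clique_join_cases)
    fix A B assume "twin_free_clique G A" "twin_free_clique H B" "card C = card A + card B"
    then show ?thesis
      using C(2) G.card_le_twin_free_clique_number[of A] H.card_le_twin_free_clique_number[of B]
      by simp
  qed
  obtain A where A: "twin_free_clique G A" "card A = twin_free_clique_number G"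
    using G.twin_free_clique_number_attained by blast
  obtain B where B: "twin_free_clique H B" "card B = twin_free_clique_number H"
    using H.twin_free_clique_number_attained by blast
  show "twin_free_clique_number G + twin_free_clique_number H
      \<le> twin_free_clique_number (graph_join G H)"
    using card_Plus_le_join[OF A(1) B(1)] A(2) B(2) assms by auto
qed

text \<open>One part of a clique of the join avoids universal vertices and so is at least one short
  of its maximum. Conversely, deleting the universal vertices from a maximum clique of
  \<open>G\<close> costs at most one and makes it compatible with any clique of
  \<open>H\<close>.\<close>

lemma twin_free_clique_number_join_universal:
  assumes U: "universal_verts G \<noteq> {}" "universal_verts H \<noteq> {}"
  shows "twin_free_clique_number (graph_join G H) + 1
    = twin_free_clique_number G + twin_free_clique_number H"
proof (rule antisym)
  obtain C where C: "twin_free_clique (graph_join G H) C"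
      "card C = twin_free_clique_number (graph_join G H)"
    using J.twin_free_clique_number_attained by blast
  show "twin_free_clique_number (graph_join G H) + 1
      \<le> twin_free_clique_number G + twin_free_clique_number H"
    using C(1)
  proof (rule twin_free_clique_join_cases)
    fix A B assume AB: "twin_free_clique G A" "twin_free_clique H B"
      "A \<inter> universal_verts G = {} \<or> B \<inter> universal_verts H = {}"
      "card C = card A + card B"
    then show ?thesis
      using C(2) U
        G.card_le_twin_free_clique_number[of A] H.card_le_twin_free_clique_number[of B]
        G.card_less_twin_free_clique_number[of A] H.card_less_twin_free_clique_number[of B]
      by auto
  qed
  obtain A where A: "twin_free_clique G A" "card A = twin_free_clique_number G"
    using G.twin_free_clique_number_attained by blast
  obtain B where B: "twin_free_clique H B" "card B = twin_free_clique_number H"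
    using H.twin_free_clique_number_attained by blast
  have "card (A - universal_verts G) + card B \<le> twin_free_clique_number (graph_join G H)"
    using A B by (intro card_Plus_le_join) (auto intro: G.twin_free_clique_mono)
  moreover have "card A = card (A \<inter> universal_verts G) + card (A - universal_verts G)"
    using card_Int_Diff G.finite_twin_free_clique[OF A(1)] by blast
  ultimately show "twin_free_clique_number G + twin_free_clique_number H
      \<le> twin_free_clique_number (graph_join G H) + 1"
    using G.card_clique_Int_universal[OF A(1)] A(2) B(2) by simp
qed

end

theorem theorem4:
  fixes G :: "'a pair_pre_digraph" and H :: "'b pair_pre_digraph"
    and n1 n2 d1 d2 :: nat
  assumes "pair_graph G" and "Digraph_Component.connected (with_proj G)"
    and "pair_graph H" and "Digraph_Component.connected (with_proj H)"
    and "n1 = card (pverts G)" and "n1 \<ge> 2"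
    and "n2 = card (pverts H)" and "n2 \<ge> 2"
    and "d1 = max_degree G" and "d2 = max_degree H"
  shows
    "(d1 \<noteq> n1 - 1 \<or> d2 \<noteq> n2 - 1 \<longrightarrow>
        int (strong_metric_dim (graph_join G H)) =
          int n1 + int n2 - int (twin_free_clique_number G) - int (twin_free_clique_number H) \<and>
        int n1 + int n2 - int (twin_free_clique_number G) - int (twin_free_clique_number H) \<ge>
          int (strong_metric_dim G) + int (strong_metric_dim H)) \<and>
     (graph_diameter G = 2 \<and> graph_diameter H = 2 \<and> (d1 \<noteq> n1 - 1 \<or> d2 \<noteq> n2 - 1) \<longrightarrow>
        strong_metric_dim (graph_join G H) = strong_metric_dim G + strong_metric_dim H) \<and>
     (d1 = n1 - 1 \<and> d2 = n2 - 1 \<longrightarrow>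
        strong_metric_dim (graph_join G H) = strong_metric_dim G + strong_metric_dim H + 1)"
proof -
  interpret two_graphs G H using assms by (simp add: two_graphs_def)
  have ne: "pverts G \<noteq> {}" "pverts H \<noteq> {}" using assms by auto
  have conn: "strongly_connected G" "strongly_connected H"
    using assms G.symmetric_connected_imp_strongly_connected
      H.symmetric_connected_imp_strongly_connected G.pair_sym_arcs H.pair_sym_arcs by auto
  have univ: "d1 = n1 - 1 \<longleftrightarrow> universal_verts G \<noteq> {}" "d2 = n2 - 1 \<longleftrightarrow> universal_verts H \<noteq> {}"
    using assms ne G.max_degree_eq_iff H.max_degree_eq_iff by auto
  \<comment> \<open>The exact formula always holds for the join, so each case reduces to linear
    arithmetic with the clique numbers.\<close>
  have join: "strong_metric_dim (graph_join G H) + twin_free_clique_number (graph_join G H)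
      = n1 + n2"
    using J.strong_metric_dim_add_eq[OF common_nbrs_graph_join[OF ne]] ne assms
      G.pair_finite_verts H.pair_finite_verts by (simp add: card_Plus)
  \<comment> \<open>Connectedness of the factors gives only this bound, the source of the inequality
    in the first case.\<close>
  have le: "strong_metric_dim G + twin_free_clique_number G \<le> n1"
      "strong_metric_dim H + twin_free_clique_number H \<le> n2"
    using G.strong_metric_dim_add_le H.strong_metric_dim_add_le conn assms by auto
  \<comment> \<open>The condition comes from diameter two in the second case and from universal
    vertices in the third.\<close>
  have eq: "strong_metric_dim G + twin_free_clique_number G = n1" if "common_nbrs G"
    using G.strong_metric_dim_add_eq that ne assms by simp
  have eq': "strong_metric_dim H + twin_free_clique_number H = n2" if "common_nbrs H"
    using H.strong_metric_dim_add_eq that ne assms by simp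
  show ?thesis
  proof (intro conjI impI)
    assume "d1 \<noteq> n1 - 1 \<or> d2 \<noteq> n2 - 1"
    then have "twin_free_clique_number (graph_join G H)
        = twin_free_clique_number G + twin_free_clique_number H"
      using twin_free_clique_number_join univ by blast
    with join le
    show "int (strong_metric_dim (graph_join G H)) =
          int n1 + int n2 - int (twin_free_clique_number G) - int (twin_free_clique_number H)"
      and "int n1 + int n2 - int (twin_free_clique_number G) - int (twin_free_clique_number H) \<ge>
          int (strong_metric_dim G) + int (strong_metric_dim H)"
      by linarith+
  next
    assume a: "graph_diameter G = 2 \<and> graph_diameter H = 2 \<and> (d1 \<noteq> n1 - 1 \<or> d2 \<noteq> n2 - 1)"
    then have "twin_free_clique_number (graph_join G H)
        = twin_free_clique_number G + twin_free_clique_number H"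
      using twin_free_clique_number_join univ by blast
    moreover have "common_nbrs G" "common_nbrs H"
      using a conn G.diameter_two_common_nbrs H.diameter_two_common_nbrs by auto
    ultimately show
      "strong_metric_dim (graph_join G H) = strong_metric_dim G + strong_metric_dim H"
      using join eq eq' by linarith
  next
    assume "d1 = n1 - 1 \<and> d2 = n2 - 1"
    then have U: "universal_verts G \<noteq> {}" "universal_verts H \<noteq> {}" using univ by auto
    then have "twin_free_clique_number (graph_join G H) + 1
        = twin_free_clique_number G + twin_free_clique_number H"
      by (rule twin_free_clique_number_join_universal)
    moreover have "common_nbrs G" "common_nbrs H"
      using U G.universal_common_nbrs H.universal_common_nbrs by auto
    ultimately show
      "strong_metric_dim (graph_join G H) = strong_metric_dim G + strong_metric_dim H + 1"
      using join eq eq' by linarith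
  qed
qed

end
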